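(* Assume the standing assumptions (i)--(iii), the bounded-iterates assumption, and $M\ge L_2$ (all in the context), and consider iterates generated by DisGrem. Let $k\ge 0$ be such that $A_k^{\mathrm{ref}}$ is nonsingular, and suppose that for some $\eta\in(0,1)$ the following hold at iteration $k$: (1) $\displaystyle \|\bar s_k-s_k^{\mathrm{ref}}\|\le \frac{\eta}{8}\cdot\frac{\lambda_k}{M_{H,\max}+\lambda_k}\,\|\bar s_k\|$; (2) $\displaystyle L_1D(X_k)\le\frac{\eta}{8}\lambda_k\|\bar s_k\|$; (3) $\displaystyle L_2D(X_k)\le\frac{\eta}{8}\lambda_k$. Then, with $r_k:=(\nabla^2 f(\bar x_k)+\lambda_kI)\bar s_k+\nabla f(\bar x_k)$, $$\|r_k\|\le\eta\,\lambda_k\|\bar s_k\|\qquad\text{and}\qquad L_2\|\bar s_k\|\le\lambda_k .$$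
   Context: Norms: $\|\cdot\|$ is the Euclidean norm for vectors; $\|\cdot\|_2$ is the spectral norm for matrices. Problem and standing assumptions. $f=\frac1N\sum_{i=1}^N f_i$ with $f_i:\mathbb R^d\to\mathbb R$. (i) Each $f_i$ is convex, twice continuously differentiable, with $\|\nabla f_i(x)-\nabla f_i(y)\|\le L_1\|x-y\|$ and $\|\nabla^2 f_i(x)-\nabla^2 f_i(y)\|_2\le L_2\|x-y\|$ for all $x,y$. (ii) $W\in\mathbb R^{N\times N}$ is entrywise nonnegative, symmetric, doubly stochastic, with positive diagonal, and $\rho:=\|W-\frac1N\mathbf 1\mathbf 1^\top\|_2<1$. (iii) $f$ is coercive. Algorithm DisGrem. Inputs: $x_{i,0}\in\mathbb R^d$ ($i=1,\dots,N$), $M>0$, integers $\tau_k,t_k\ge1$. Initialize $g_{i,0}=\nabla f_i(x_{i,0})$, $H_{i,0}=\nabla^2 f_i(x_{i,0})$. For $k\ge 0$: (A) $\tilde x_{i,k}=\sum_j[W^{\tau_k}]_{ij}x_{j,k}$, $\tilde g_{i,k}=\sum_j[W^{\tau_k}]_{ij}g_{j,k}$, $\tilde H_{i,k}=\sum_j[W^{\tau_k}]_{ij}H_{j,k}$. (B) $\lambda_{i,k}=\sqrt{M\|\tilde g_{i,k}\|}$, $\delta_{i,k}=\max\{0,-\lambda_{\min}(\tilde H_{i,k})\}$; if $\tilde g_{i,k}=0$ then $s_{i,k}=0$, otherwise $s_{i,k}$ solves $(\tilde H_{i,k}+(\lambda_{i,k}+\delta_{i,k})I)s_{i,k}=-\tilde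 g_{i,k}$. (C) $x_{i,k+1}=\sum_j[W^{t_k}]_{ij}(\tilde x_{j,k}+s_{j,k})$. (D) $g_{i,k+1}=\sum_j[W^{t_k}]_{ij}(\tilde g_{j,k}+\nabla f_j(x_{j,k+1})-\nabla f_j(x_{j,k}))$ and $H_{i,k+1}=\sum_j[W^{t_k}]_{ij}(\tilde H_{j,k}+\nabla^2 f_j(x_{j,k+1})-\nabla^2 f_j(x_{j,k}))$. Bounded-iterates assumption. There are $x_\star\in\arg\min f$ and a finite $D>0$ such that $\|\bar x_k-x_\star\|\le D$, $\|x_{i,k}-x_\star\|\le D$, $\|\tilde x_{i,k}-x_\star\|\le D$ for all $k\ge0$ and all $i$. Notation. $\bar x_k=\frac1N\sum_i x_{i,k}$, $\bar s_k=\frac1N\sum_i s_{i,k}$, $\tilde{\bar g}_k=\frac1N\sum_i\tilde g_{i,k}$, $\tilde{\bar H}_k=\frac1N\sum_i\tilde H_{i,k}$, $\lambda_k=\frac1N\sum_i(\lambda_{i,k}+\delta_{i,k})$, $M_{H,\max}=L_1$. $D(X_k)=\bigl(\frac1N\sum_i\|x_{i,k}-\bar x_k\|^2\bigr)^{1/2}$ (not to be confused with the constant $D$). $A_k^{\mathrm{ref}}=\tilde{\bar H}_k+\lambda_kI$ and, when it is nonsingular, $s_k^{\mathrm{ref}}=-(A_k^{\mathrm{ref}})^{-1}\tilde{\bar g}_k$. *)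

theory Defs
  imports "HOL-Analysis.Analysis"
begin

definition gradient :: "(real^'d \<Rightarrow> real) \<Rightarrow> real^'d \<Rightarrow> real^'d" where
  "gradient f x = (\<chi> j. frechet_derivative f (at x) (axis j 1))"

definition hessian :: "(real^'d \<Rightarrow> real) \<Rightarrow> real^'d \<Rightarrow> real^'d^'d" where
  "hessian f x = jacobian (gradient f) (at x)"

definition twice_continuously_differentiable :: "(real^'d \<Rightarrow> real) \<Rightarrow> bool" where
  "twice_continuously_differentiable f \<longleftrightarrow>
     f differentiable_on UNIV \<and> gradient f differentiable_on UNIV \<and>
     continuous_on UNIV (hessian f)"

definition coercive :: "('a::real_normed_vector \<Rightarrow> real) \<Rightarrow> bool" where
  "coercive f \<longleftrightarrow> filterlim f at_top at_infinity"

(* The type-class norm on real^'m^'n is the Frobenius norm, hence the explicit operator norm. *)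
definition spectral_norm :: "real^'m^'n \<Rightarrow> real" where
  "spectral_norm A = onorm (\<lambda>v. A *v v)"

(* Only meaningful if A has a real eigenvalue; it is applied to symmetric A. *)
definition lambda_min :: "real^'d^'d \<Rightarrow> real" where
  "lambda_min A = Min {e. \<exists>v. v \<noteq> 0 \<and> A *v v = e *\<^sub>R v}"

(* The operations * and ^ on the type real^'n^'n are componentwise, so they do not give
   matrix powers. *)
definition mat_pow :: "real^'n^'n \<Rightarrow> nat \<Rightarrow> real^'n^'n" where
  "mat_pow A p = (((**) A) ^^ p) (mat 1)"

definition doubly_stochastic :: "real^'n^'n \<Rightarrow> bool" where
  "doubly_stochastic W \<longleftrightarrow>
     (\<forall>i j. 0 \<le> W $ i $ j) \<and> (\<forall>i. (\<Sum>j\<in>UNIV. W $ i $ j) = 1) \<and>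
     (\<forall>j. (\<Sum>i\<in>UNIV. W $ i $ j) = 1)"

definition avg :: "('n::finite \<Rightarrow> 'a::real_vector) \<Rightarrow> 'a" where
  "avg z = (1 / real CARD('n)) *\<^sub>R (\<Sum>i\<in>UNIV. z i)"

definition mix :: "real^'n^'n \<Rightarrow> ('n \<Rightarrow> 'a::real_vector) \<Rightarrow> 'n \<Rightarrow> 'a" where
  "mix P z i = (\<Sum>j\<in>UNIV. P $ i $ j *\<^sub>R z j)"

definition consensus_dev :: "('n::finite \<Rightarrow> 'a::real_normed_vector) \<Rightarrow> real" where
  "consensus_dev z = sqrt (avg (\<lambda>i. (norm (z i - avg z))\<^sup>2))"

(* A run of DisGrem: the agents are the elements of 'n and the first argument of every
   sequence is the iteration counter. The letters xt, gt, Ht stand for x, g, H with a tilde. *)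
locale disgrem =
  fixes f :: "'n::finite \<Rightarrow> real^'d::finite \<Rightarrow> real"
    and W :: "real^'n^'n"
    and M :: real
    and \<tau> t :: "nat \<Rightarrow> nat"
    and x g :: "nat \<Rightarrow> 'n \<Rightarrow> real^'d"
    and H :: "nat \<Rightarrow> 'n \<Rightarrow> real^'d^'d"
    and xt gt :: "nat \<Rightarrow> 'n \<Rightarrow> real^'d"
    and Ht :: "nat \<Rightarrow> 'n \<Rightarrow> real^'d^'d"
    and lam del :: "nat \<Rightarrow> 'n \<Rightarrow> real"
    and s :: "nat \<Rightarrow> 'n \<Rightarrow> real^'d"
  assumes M_pos: "M > 0"
    and tau_ge: "\<tau> k \<ge> 1"
    and t_ge: "t k \<ge> 1"
    and g_0: "g 0 i = gradient (f i) (x 0 i)"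
    and H_0: "H 0 i = hessian (f i) (x 0 i)"
    and xt_eq: "xt k i = mix (mat_pow W (\<tau> k)) (x k) i"
    and gt_eq: "gt k i = mix (mat_pow W (\<tau> k)) (g k) i"
    and Ht_eq: "Ht k i = mix (mat_pow W (\<tau> k)) (H k) i"
    and lam_eq: "lam k i = sqrt (M * norm (gt k i))"
    and del_eq: "del k i = max 0 (- lambda_min (Ht k i))"
    and s_zero: "gt k i = 0 \<Longrightarrow> s k i = 0"
    and s_solves: "gt k i \<noteq> 0 \<Longrightarrow>
        (Ht k i + (lam k i + del k i) *\<^sub>R mat 1) *v s k i = - gt k i"
    and x_Suc: "x (Suc k) i = mix (mat_pow W (t k)) (\<lambda>j. xt k j + s k j) i"
    and g_Suc: "g (Suc k) i = mix (mat_pow W (t k))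
        (\<lambda>j. gt k j + gradient (f j) (x (Suc k) j) - gradient (f j) (x k j)) i"
    and H_Suc: "H (Suc k) i = mix (mat_pow W (t k))
        (\<lambda>j. Ht k j + hessian (f j) (x (Suc k) j) - hessian (f j) (x k j)) i"

definition bounded_iterates ::
  "(real^'d \<Rightarrow> real) \<Rightarrow> (nat \<Rightarrow> 'n::finite \<Rightarrow> real^'d) \<Rightarrow> (nat \<Rightarrow> 'n \<Rightarrow> real^'d) \<Rightarrow> bool" where
  "bounded_iterates F x xt \<longleftrightarrow>
     (\<exists>xstar D. is_arg_min F (\<lambda>_. True) xstar \<and> D > 0 \<and>
        (\<forall>k. norm (avg (x k) - xstar) \<le> D) \<and>
        (\<forall>k i. norm (x k i - xstar) \<le> D) \<and>
        (\<forall>k i. norm (xt k i - xstar) \<le> D))"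

end

theory Submission
  imports Defs
begin
text \<open>
  Mixing with a doubly stochastic matrix preserves averages, so gradient tracking makes the
  averages of the local estimates \<open>gt k\<close> and \<open>Ht k\<close> equal to the averages of the true local
  gradients and Hessians, taken at the local points \<open>x k i\<close> (\<open>tracking_average\<close>).  The residual
  therefore splits into three parts (\<open>newton_residual_decomposition\<close>): the reference matrix applied
  to \<open>sbar - sref\<close>, and the errors made by evaluating the Hessians and the gradients at the local
  points instead of at their average.  The reference matrix has operator norm at most \<open>L1 + lamk\<close>,
  because a derivative is bounded by the Lipschitz constant of its function; the other two errors
  are at most the respective Lipschitz constant times the consensus deviation
  (\<open>norm_average_error\<close>).  Under the three smallness conditions each part is at most
  \<open>\<eta> / 8 * lamk * norm sbar\<close>, and the sum of the three stays below the claimed bound.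

  For the step length, each agent regularizes with \<open>\<lambda> + \<delta>\<close> where \<open>\<lambda>\<^sup>2 = M * norm g\<close> and \<open>\<delta>\<close> lifts the
  Hessian estimate to a positive semidefinite matrix.  Pairing the step equation with \<open>s\<close> gives
  \<open>\<lambda> * norm s \<le> norm g\<close>, hence \<open>M * norm s \<le> \<lambda>\<close> (\<open>scaled_step_le_regularization\<close>), and averaging this
  over the agents yields \<open>M * norm sbar \<le> lamk\<close>.  That \<open>\<delta>\<close> has the claimed effect rests on the
  Rayleigh characterization of the least eigenvalue (\<open>lambda_min_le_rayleigh\<close>), which needs the
  estimates to be symmetric.  They are linear combinations of Hessians, and Hessians are symmetric
  by Schwarz's theorem (\<open>hessian_inner_commute\<close>).
\<close>


section \<open>Averages and mixing\<close>

lemma avg_add: "avg (\<lambda>i. a i + b i) = avg a + avg b"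
  by (simp add: avg_def sum.distrib scaleR_add_right)

lemma avg_diff: "avg (\<lambda>i. a i - b i) = avg a - avg b"
  by (simp add: avg_def sum_subtractf scaleR_diff_right)

lemma avg_mono: "(\<And>i. a i \<le> b i) \<Longrightarrow> avg a \<le> avg b" for a b :: "'n::finite \<Rightarrow> real"
  by (simp add: avg_def divide_right_mono sum_mono)

lemma avg_const: "avg (\<lambda>i::'n::finite. c) = c"
  by (simp add: avg_def sum_constant_scaleR)

lemma avg_mult_left: "avg (\<lambda>i. c * a i) = c * avg a" for a :: "'n::finite \<Rightarrow> real"
  by (simp add: avg_def sum_distrib_left)

lemma norm_avg_le: "norm (avg z) \<le> avg (\<lambda>i. norm (z i))"
  by (simp add: avg_def divide_right_mono norm_sum)

lemma linear_avg: "linear h \<Longrightarrow> h (avg z) = avg (\<lambda>i. h (z i))"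
  by (simp add: avg_def linear_scale linear_sum)

lemma matrix_vector_mult_scaleR_left: "(c *\<^sub>R A) *v v = c *\<^sub>R (A *v v)"
  for A :: "real^'m^'n"
  by (simp add: scaleR_matrix_vector_assoc)

lemma linear_matrix_vector_mult_left: "linear (\<lambda>A :: real^'m^'n. A *v v)"
  by (rule linearI) (simp_all add: matrix_vector_mult_add_rdistrib matrix_vector_mult_scaleR_left)

lemma avg_matrix_vector_mult: "avg A *v v = avg (\<lambda>i. A i *v v)" for A :: "'n::finite \<Rightarrow> real^'d^'d"
  by (rule linear_avg [OF linear_matrix_vector_mult_left])

text \<open>
  The mean is at most the root mean square, by the Cauchy--Schwarz inequality.
\<close>

lemma avg_dev_le_consensus_dev: "avg (\<lambda>i. norm (z i - avg z)) \<le> consensus_dev z"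
  for z :: "'n::finite \<Rightarrow> 'a::real_normed_vector"
proof -
  let ?a = "\<lambda>i. norm (z i - avg z)"
  have "(\<Sum>i\<in>UNIV. ?a i)\<^sup>2 \<le> (\<Sum>i\<in>UNIV. (?a i)\<^sup>2) * real CARD('n)"
    by (rule sum_squared_le_sum_of_squares)
  then have "(avg ?a)\<^sup>2 \<le> avg (\<lambda>i. (?a i)\<^sup>2)"
    by (simp add: avg_def divide_simps power2_eq_square)
  then show ?thesis
    unfolding consensus_dev_def by (rule real_le_rsqrt)
qed

lemma mat_pow_column_sum:
  assumes "doubly_stochastic W"
  shows "(\<Sum>i\<in>UNIV. mat_pow W p $ i $ j) = 1"
proof (induction p arbitrary: j)
  case 0
  show ?case by (simp add: mat_pow_def mat_def)
next
  case (Suc p)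
  have col: "(\<Sum>i\<in>UNIV. W $ i $ l) = 1" for l
    using assms by (simp add: doubly_stochastic_def)
  have "(\<Sum>i\<in>UNIV. mat_pow W (Suc p) $ i $ j)
      = (\<Sum>i\<in>UNIV. \<Sum>l\<in>UNIV. W $ i $ l * mat_pow W p $ l $ j)"
    by (simp add: mat_pow_def matrix_matrix_mult_def)
  also have "\<dots> = (\<Sum>l\<in>UNIV. (\<Sum>i\<in>UNIV. W $ i $ l) * mat_pow W p $ l $ j)"
    by (subst sum.swap) (simp add: sum_distrib_right)
  also have "\<dots> = 1"
    using Suc by (simp add: col)
  finally show ?case .
qed

text \<open>
  An average weights all agents equally, so only the column sums of the mixing matrix enter it.
\<close>

lemma avg_mix:
  fixes z :: "'n::finite \<Rightarrow> 'a::real_vector"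
  assumes "doubly_stochastic W"
  shows "avg (mix (mat_pow W p) z) = avg z"
proof -
  have "(\<Sum>i\<in>UNIV. mix (mat_pow W p) z i) = (\<Sum>j\<in>UNIV. (\<Sum>i\<in>UNIV. mat_pow W p $ i $ j) *\<^sub>R z j)"
    unfolding mix_def by (subst sum.swap) (simp add: scaleR_left.sum)
  then show ?thesis
    by (simp add: avg_def mat_pow_column_sum [OF assms])
qed

text \<open>
  Gradient tracking: since mixing preserves averages, the increments added to the local
  estimates telescope. The argument is the same for the tracked gradients and Hessians.
\<close>

lemma tracking_average:
  fixes q qt :: "nat \<Rightarrow> 'n::finite \<Rightarrow> 'a::real_vector" and v :: "nat \<Rightarrow> 'n \<Rightarrow> 'a"
  assumes W: "doubly_stochastic W"
    and q0: "\<And>i. q 0 i = v 0 i"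
    and qt: "\<And>k i. qt k i = mix (mat_pow W (a k)) (q k) i"
    and qS: "\<And>k i. q (Suc k) i = mix (mat_pow W (b k)) (\<lambda>j. qt k j + v (Suc k) j - v k j) i"
  shows "avg (qt k) = avg (v k)"
proof -
  have mixed: "avg (qt k) = avg (q k)" for k
  proof -
    have "qt k = mix (mat_pow W (a k)) (q k)" by (rule ext) (rule qt)
    then show ?thesis by (simp add: avg_mix [OF W])
  qed
  have "avg (q k) = avg (v k)"
  proof (induction k)
    case 0
    show ?case by (simp add: q0 avg_def)
  next
    case (Suc k)
    have "q (Suc k) = mix (mat_pow W (b k)) (\<lambda>j. qt k j + v (Suc k) j - v k j)"
      by (rule ext) (rule qS)
    then have "avg (q (Suc k)) = avg (\<lambda>j. qt k j + v (Suc k) j - v k j)"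
      by (simp add: avg_mix [OF W])
    also have "\<dots> = avg (v (Suc k))"
      by (simp add: avg_add avg_diff mixed Suc)
    finally show ?case .
  qed
  with mixed show ?thesis by simp
qed

section \<open>Gradients and Hessians\<close>

lemma has_derivative_gradient:
  assumes "f differentiable (at x)"
  shows "(f has_derivative (\<lambda>h. gradient f x \<bullet> h)) (at x)"
proof -
  let ?D = "frechet_derivative f (at x)"
  have D: "(f has_derivative ?D) (at x)"
    using assms by (simp add: frechet_derivative_works)
  then have lin: "linear ?D" by (rule has_derivative_linear)
  have "?D h = gradient f x \<bullet> h" for h
  proof -
    have "?D h = ?D (\<Sum>j\<in>UNIV. (h $ j) *\<^sub>R axis j 1)"
      by (simp add: basis_expansion flip: scalar_mult_eq_scaleR)
    also have "\<dots> = (\<Sum>j\<in>UNIV. h $ j * ?D (axis j 1))"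
      by (simp add: linear_sum [OF lin] linear_scale [OF lin])
    also have "\<dots> = gradient f x \<bullet> h"
      by (simp add: gradient_def inner_vec_def mult.commute)
    finally show ?thesis .
  qed
  then have "?D = (\<lambda>h. gradient f x \<bullet> h)" by (rule ext)
  with D show ?thesis by simp
qed

lemma gradient_unique:
  assumes "(f has_derivative (\<lambda>h. a \<bullet> h)) (at x)"
  shows "gradient f x = a"
  by (simp add: gradient_def frechet_derivative_at [OF assms, symmetric] inner_axis vec_eq_iff)

lemma has_derivative_hessian:
  assumes "gradient f differentiable (at x)"
  shows "(gradient f has_derivative (\<lambda>h. hessian f x *v h)) (at x)"
  using assms unfolding hessian_def by (simp add: jacobian_works)

lemma hessian_unique:
  assumes "(gradient f has_derivative (\<lambda>h. A *v h)) (at x)"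
  shows "hessian f x = A"
  by (simp add: hessian_def jacobian_def frechet_derivative_at [OF assms, symmetric]
      matrix_of_matrix_vector_mul)

lemma has_derivative_avg:
  fixes f :: "'n::finite \<Rightarrow> 'a::real_normed_vector \<Rightarrow> 'b::real_normed_vector"
  assumes "\<And>i. (f i has_derivative f' i) F"
  shows "((\<lambda>y. avg (\<lambda>i. f i y)) has_derivative (\<lambda>h. avg (\<lambda>i. f' i h))) F"
  unfolding avg_def by (intro has_derivative_scaleR_right has_derivative_sum assms)

lemma gradient_avg:
  assumes "\<And>i. f i differentiable (at x)"
  shows "gradient (\<lambda>y. avg (\<lambda>i. f i y)) x = avg (\<lambda>i. gradient (f i) x)"
proof (rule gradient_unique)
  have "((\<lambda>y. avg (\<lambda>i. f i y)) has_derivative (\<lambda>h. avg (\<lambda>i. gradient (f i) x \<bullet> h))) (at x)"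
    by (intro has_derivative_avg has_derivative_gradient assms)
  then show "((\<lambda>y. avg (\<lambda>i. f i y)) has_derivative (\<lambda>h. avg (\<lambda>i. gradient (f i) x) \<bullet> h)) (at x)"
    by (simp add: avg_def inner_sum_left)
qed

lemma hessian_avg:
  assumes "\<And>i y. f i differentiable (at y)" and "\<And>i. gradient (f i) differentiable (at x)"
  shows "hessian (\<lambda>y. avg (\<lambda>i. f i y)) x = avg (\<lambda>i. hessian (f i) x)"
proof (rule hessian_unique)
  have "((\<lambda>y. avg (\<lambda>i. gradient (f i) y)) has_derivative
      (\<lambda>h. avg (\<lambda>i. hessian (f i) x *v h))) (at x)"
    by (intro has_derivative_avg has_derivative_hessian assms)
  then show "(gradient (\<lambda>y. avg (\<lambda>i. f i y)) has_derivative
      (\<lambda>h. avg (\<lambda>i. hessian (f i) x) *v h)) (at x)"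
    by (simp add: gradient_avg [OF assms(1), abs_def] avg_matrix_vector_mult)
qed

text \<open>
  Along the ray from \<open>x\<close> in direction \<open>v\<close>, the difference quotients of \<open>G\<close> have norm at most
  \<open>L * norm v\<close> and converge to \<open>G' v\<close>.
\<close>

lemma norm_derivative_le_lipschitz:
  fixes G :: "'a::real_normed_vector \<Rightarrow> 'b::real_normed_vector"
  assumes D: "(G has_derivative G') (at x)"
    and L: "\<And>y z. norm (G y - G z) \<le> L * norm (y - z)"
  shows "norm (G' v) \<le> L * norm v"
proof (rule field_le_epsilon)
  fix e :: real assume "e > 0"
  define e' where "e' = e / (norm v + 1)"
  have e': "e' > 0" "e' * norm v \<le> e"
    using \<open>e > 0\<close> by (auto simp: e'_def divide_simps add_nonneg_pos)
  obtain d where d: "d > 0"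
    "\<And>y. norm (y - x) < d \<Longrightarrow> norm (G y - G x - G' (y - x)) \<le> e' * norm (y - x)"
    using D e'(1) unfolding has_derivative_at_alt by blast
  \<comment> \<open>The summand \<open>1\<close> avoids a division by zero for \<open>v = 0\<close>.\<close>
  define h where "h = d / 2 / (norm v + 1)"
  have h: "h > 0" "norm (h *\<^sub>R v) < d"
    using \<open>d > 0\<close> by (auto simp: h_def divide_simps add_nonneg_pos)
  have "linear G'" using D by (rule has_derivative_linear)
  then have "norm (h *\<^sub>R G' v) = norm (G' ((x + h *\<^sub>R v) - x))"
    by (simp add: linear_scale)
  also have "\<dots> \<le> norm (G (x + h *\<^sub>R v) - G x) +
      norm (G (x + h *\<^sub>R v) - G x - G' ((x + h *\<^sub>R v) - x))"
    by (metis norm_triangle_sub norm_minus_commute)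
  also have "\<dots> \<le> L * norm (h *\<^sub>R v) + e' * norm (h *\<^sub>R v)"
    using L [of "x + h *\<^sub>R v" x] d(2) [of "x + h *\<^sub>R v"] h(2) by simp
  finally have "h * norm (G' v) \<le> h * (L * norm v + e' * norm v)"
    using h(1) by (simp add: algebra_simps)
  then have "norm (G' v) \<le> L * norm v + e' * norm v"
    using h(1) by simp
  with e'(2) show "norm (G' v) \<le> L * norm v + e" by linarith
qed

text \<open>
  The mixed second difference of \<open>f\<close> over a parallelogram approximates the Hessian form.  The mean
  value theorem along \<open>u\<close> turns it into a difference of gradients at two points displaced by
  \<open>h *\<^sub>R v\<close>, and both gradients are close to the linearization at \<open>x\<close>, so their difference is close
  to \<open>h *\<^sub>R (A *v v)\<close>.
\<close>

lemma second_difference_estimate: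
  fixes f :: "real^'d::finite \<Rightarrow> real" and A :: "real^'d^'d"
  assumes f: "\<And>y. f differentiable (at y)"
    and near: "\<And>w. norm w < d \<Longrightarrow> norm (gradient f (x + w) - gradient f x - A *v w) \<le> e * norm w"
    and h: "h > 0" "h * (norm u + norm v) < d" and e: "e \<ge> 0"
  shows "\<bar>f (x + h *\<^sub>R u + h *\<^sub>R v) - f (x + h *\<^sub>R u) - f (x + h *\<^sub>R v) + f x - h\<^sup>2 * (u \<bullet> (A *v v))\<bar>
    \<le> h\<^sup>2 * (2 * e * (norm u + norm v)\<^sup>2)"
proof -
  let ?G = "gradient f" and ?n = "norm u + norm v"
  \<comment> \<open>The second difference is the increment over \<open>{0..h}\<close> of the first difference in direction \<open>v\<close>.\<close>
  define \<phi> where "\<phi> s = f (x + s *\<^sub>R u + h *\<^sub>R v) - f (x + s *\<^sub>R u)" for s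
  have line: "((\<lambda>s. f (c + s *\<^sub>R u)) has_derivative (\<lambda>r. ?G (c + s *\<^sub>R u) \<bullet> (r *\<^sub>R u))) (at s)" for c s
    by (rule has_derivative_compose [OF _ has_derivative_gradient [OF f]])
       (auto intro!: derivative_eq_intros)
  have "(\<phi> has_derivative (\<lambda>r. r * ((?G (x + s *\<^sub>R u + h *\<^sub>R v) - ?G (x + s *\<^sub>R u)) \<bullet> u))) (at s)" for s
    unfolding \<phi>_def
    using has_derivative_diff [OF line [of "x + h *\<^sub>R v" s] line [of x s]]
    by (simp add: algebra_simps)
  then have "\<exists>s\<in>{0<..<h}. \<phi> h - \<phi> 0 =
      (h - 0) * ((?G (x + s *\<^sub>R u + h *\<^sub>R v) - ?G (x + s *\<^sub>R u)) \<bullet> u)"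
    using h(1) by (intro mvt_simple) (auto intro: has_derivative_at_withinI)
  then obtain s where s: "0 < s" "s < h"
    and eq: "\<phi> h - \<phi> 0 = h * ((?G (x + s *\<^sub>R u + h *\<^sub>R v) - ?G (x + s *\<^sub>R u)) \<bullet> u)"
    by auto
  let ?w = "s *\<^sub>R u + h *\<^sub>R v"
  have "norm (s *\<^sub>R u) \<le> h * norm u"
    using s by (simp add: mult_right_mono)
  then have w: "norm ?w \<le> h * ?n" "norm (s *\<^sub>R u) \<le> h * ?n"
    using norm_triangle_ineq [of "s *\<^sub>R u" "h *\<^sub>R v"] h(1) by (auto simp: algebra_simps intro: order_trans)
  let ?p = "?G (x + ?w) - ?G x - A *v ?w" and ?q = "?G (x + s *\<^sub>R u) - ?G x - A *v (s *\<^sub>R u)"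
  have "norm ?p \<le> e * (h * ?n)" "norm ?q \<le> e * (h * ?n)"
    using near [of ?w] near [of "s *\<^sub>R u"] w h(2) mult_left_mono [OF w(1) e] mult_left_mono [OF w(2) e]
    by linarith+
  then have pq: "norm (?p - ?q) \<le> 2 * e * h * ?n"
    using norm_triangle_ineq4 [of ?p ?q] by simp
  have "?p - ?q = ?G (x + ?w) - ?G (x + s *\<^sub>R u) - h *\<^sub>R (A *v v)"
    by (simp add: algebra_simps)
  then have "f (x + h *\<^sub>R u + h *\<^sub>R v) - f (x + h *\<^sub>R u) - f (x + h *\<^sub>R v) + f x - h\<^sup>2 * (u \<bullet> (A *v v))
      = h * ((?p - ?q) \<bullet> u)"
    using eq by (simp add: \<phi>_def algebra_simps power2_eq_square inner_commute)
  moreover have "\<bar>(?p - ?q) \<bullet> u\<bar> \<le> (2 * e * h * ?n) * ?n"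
  proof -
    have "\<bar>(?p - ?q) \<bullet> u\<bar> \<le> norm (?p - ?q) * norm u" by (rule Cauchy_Schwarz_ineq2)
    also have "\<dots> \<le> (2 * e * h * ?n) * ?n"
      using pq e h(1) by (intro mult_mono) auto
    finally show ?thesis .
  qed
  then have "h * \<bar>(?p - ?q) \<bullet> u\<bar> \<le> h * ((2 * e * h * ?n) * ?n)"
    using h(1) by (intro mult_left_mono) auto
  ultimately show ?thesis
    using h(1) by (simp add: abs_mult power2_eq_square mult_ac)
qed

text \<open>
  Schwarz's theorem.  The mixed second difference is symmetric in \<open>u\<close> and \<open>v\<close>, and by the preceding
  estimate it lies within \<open>o(h\<^sup>2)\<close> both of \<open>h\<^sup>2\<close> times the left-hand side and of \<open>h\<^sup>2\<close> times the
  right-hand side.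
\<close>

lemma hessian_inner_commute:
  fixes f :: "real^'d::finite \<Rightarrow> real"
  assumes f: "\<And>y. f differentiable (at y)" and g: "gradient f differentiable (at x)"
  shows "u \<bullet> (hessian f x *v v) = v \<bullet> (hessian f x *v u)"
proof -
  let ?A = "hessian f x" and ?n = "norm u + norm v"
  have "\<bar>u \<bullet> (?A *v v) - v \<bullet> (?A *v u)\<bar> \<le> 0 + e" if "e > 0" for e :: real
  proof -
    define e' where "e' = e / (4 * (?n\<^sup>2 + 1))"
    have e': "e' > 0" "4 * e' * ?n\<^sup>2 \<le> e"
      using that by (auto simp: e'_def divide_simps add_nonneg_pos)
    obtain d where d: "d > 0" "\<And>y. norm (y - x) < d \<Longrightarrow>
        norm (gradient f y - gradient f x - ?A *v (y - x)) \<le> e' * norm (y - x)"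
      using has_derivative_hessian [OF g] e'(1) unfolding has_derivative_at_alt by blast
    have near: "norm (gradient f (x + w) - gradient f x - ?A *v w) \<le> e' * norm w" if "norm w < d" for w
      using d(2) [of "x + w"] that by simp
    define h where "h = d / (?n + 1)"
    have "?n + 1 > 0" by (simp add: add_nonneg_pos)
    then have h: "h > 0" "h * ?n < d" "h * (norm v + norm u) < d"
      using d(1) by (auto simp: h_def divide_simps algebra_simps)
    let ?\<Delta> = "f (x + h *\<^sub>R u + h *\<^sub>R v) - f (x + h *\<^sub>R u) - f (x + h *\<^sub>R v) + f x"
    have "\<bar>?\<Delta> - h\<^sup>2 * (u \<bullet> (?A *v v))\<bar> \<le> h\<^sup>2 * (2 * e' * ?n\<^sup>2)"
      using e' h by (intro second_difference_estimate [OF f near]) auto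
    moreover have "\<bar>?\<Delta> - h\<^sup>2 * (v \<bullet> (?A *v u))\<bar> \<le> h\<^sup>2 * (2 * e' * ?n\<^sup>2)"
      using second_difference_estimate [OF f near h(1) h(3)] e'(1) by (simp add: algebra_simps)
    ultimately have "\<bar>h\<^sup>2 * (u \<bullet> (?A *v v)) - h\<^sup>2 * (v \<bullet> (?A *v u))\<bar> \<le> h\<^sup>2 * (4 * e' * ?n\<^sup>2)"
      by linarith
    then have "h\<^sup>2 * \<bar>u \<bullet> (?A *v v) - v \<bullet> (?A *v u)\<bar> \<le> h\<^sup>2 * (4 * e' * ?n\<^sup>2)"
      by (simp add: abs_mult flip: right_diff_distrib)
    then have "\<bar>u \<bullet> (?A *v v) - v \<bullet> (?A *v u)\<bar> \<le> 4 * e' * ?n\<^sup>2"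
      using h(1) by (simp only: mult_le_cancel_left_pos zero_less_power)
    with e'(2) show ?thesis by simp
  qed
  then have "\<bar>u \<bullet> (?A *v v) - v \<bullet> (?A *v u)\<bar> \<le> 0"
    by (rule field_le_epsilon)
  then show ?thesis by simp
qed

section \<open>Symmetric matrices and the regularized Newton step\<close>

text \<open>
  Symmetry is stated through the bilinear form, the form in which Schwarz's theorem provides it and
  the eigenvalue arguments use it.
\<close>

definition symmetric_matrix :: "real^'d^'d \<Rightarrow> bool" where
  "symmetric_matrix A \<longleftrightarrow> (\<forall>u v. u \<bullet> (A *v v) = v \<bullet> (A *v u))"

lemma symmetric_matrix_mix:
  assumes "\<And>j. symmetric_matrix (z j)"
  shows "symmetric_matrix (mix P z i)"
proof -
  have "mix P z i *v v = (\<Sum>j\<in>UNIV. P $ i $ j *\<^sub>R (z j *v v))" for v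
    unfolding mix_def
    by (simp add: linear_sum [OF linear_matrix_vector_mult_left] matrix_vector_mult_scaleR_left)
  then show ?thesis
    using assms unfolding symmetric_matrix_def by (simp add: inner_sum_right)
qed

lemma symmetric_matrix_add: "symmetric_matrix A \<Longrightarrow> symmetric_matrix B \<Longrightarrow> symmetric_matrix (A + B)"
  by (simp add: symmetric_matrix_def matrix_vector_mult_add_rdistrib inner_add_right)

lemma symmetric_matrix_diff: "symmetric_matrix A \<Longrightarrow> symmetric_matrix B \<Longrightarrow> symmetric_matrix (A - B)"
  by (simp add: symmetric_matrix_def matrix_vector_mult_diff_rdistrib inner_diff_right)

text \<open>
  Eigenvectors of a symmetric matrix for distinct eigenvalues are orthogonal, and a set of pairwise
  orthogonal vectors in a finite-dimensional space is finite.
\<close>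

lemma symmetric_matrix_finite_eigenvalues:
  assumes "symmetric_matrix (A :: real^'d::finite^'d)"
  shows "finite {e. \<exists>v. v \<noteq> 0 \<and> A *v v = e *\<^sub>R v}" (is "finite ?E")
proof -
  obtain g where g: "\<And>e. e \<in> ?E \<Longrightarrow> g e \<noteq> 0 \<and> A *v g e = e *\<^sub>R g e"
    using bchoice [of ?E "\<lambda>e v. v \<noteq> 0 \<and> A *v v = e *\<^sub>R v"] by auto
  have orth: "g a \<bullet> g b = 0" if "a \<in> ?E" "b \<in> ?E" "a \<noteq> b" for a b
  proof -
    have "g a \<bullet> (A *v g b) = g b \<bullet> (A *v g a)"
      using assms by (simp add: symmetric_matrix_def)
    then have "b * (g a \<bullet> g b) = a * (g a \<bullet> g b)"
      using g that by (simp add: inner_commute)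
    then show ?thesis using that by simp
  qed
  have "inj_on g ?E"
    using g orth by (metis (no_types, lifting) inj_onI inner_eq_zero_iff)
  moreover have "finite (g ` ?E)"
    using orth by (intro pairwise_orthogonal_imp_finite) (auto simp: pairwise_def orthogonal_def)
  ultimately show ?thesis by (rule finite_imageD [rotated])
qed

text \<open>
  The quadratic form of \<open>A\<close> attains a minimum \<open>m\<close> on the unit sphere, at \<open>w\<close> say.  The form of
  \<open>A - m\<close> is then nonnegative and vanishes at \<open>w\<close>, so it cannot decrease in the direction of the
  residual \<open>p = A *v w - m *\<^sub>R w\<close>; this forces \<open>p = 0\<close>.
\<close>

lemma rayleigh_minimum_eigenvalue:
  assumes sym: "symmetric_matrix (A :: real^'d::finite^'d)"
  obtains m w where "w \<noteq> 0" "A *v w = m *\<^sub>R w" "\<And>u. m * (u \<bullet> u) \<le> u \<bullet> (A *v u)"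
proof -
  have "axis undefined 1 \<in> sphere (0::real^'d) 1" by simp
  then have "sphere (0::real^'d) 1 \<noteq> {}" by blast
  moreover have "continuous_on (sphere 0 1) (\<lambda>u. u \<bullet> (A *v u))"
    by (intro continuous_intros)
  ultimately obtain w where "w \<in> sphere 0 1" "\<forall>u\<in>sphere 0 1. w \<bullet> (A *v w) \<le> u \<bullet> (A *v u)"
    using continuous_attains_inf [OF compact_sphere] by blast
  then have w: "norm w = 1" and min: "\<And>u. norm u = 1 \<Longrightarrow> w \<bullet> (A *v w) \<le> u \<bullet> (A *v u)"
    by simp_all
  define m where "m = w \<bullet> (A *v w)"
  have ray: "m * (u \<bullet> u) \<le> u \<bullet> (A *v u)" for u
  proof (cases "u = 0")
    case False
    have "m \<le> (u /\<^sub>R norm u) \<bullet> (A *v (u /\<^sub>R norm u))"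
      unfolding m_def using False by (intro min) simp
    also have "\<dots> = (u \<bullet> (A *v u)) / (norm u)\<^sup>2"
      by (simp add: matrix_vector_mult_scaleR power2_eq_square divide_inverse)
    finally show ?thesis
      using False by (simp add: divide_simps dot_square_norm)
  qed simp
  define p where "p = A *v w - m *\<^sub>R w"
  define K where "K = p \<bullet> (A *v p) - m * (p \<bullet> p)"
  have K: "K \<ge> 0" using ray [of p] by (simp add: K_def)
  have ww: "w \<bullet> w = 1" using w by (simp add: dot_square_norm)
  have wp: "w \<bullet> p = 0" by (simp add: p_def m_def ww inner_diff_right)
  have sw: "p \<bullet> (A *v w) = w \<bullet> (A *v p)"
    using sym by (simp add: symmetric_matrix_def)
  have pw: "p \<bullet> (A *v w) = p \<bullet> p"
    using wp by (simp add: p_def inner_diff_right inner_diff_left inner_commute algebra_simps)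
  \<comment> \<open>Nonnegativity of the form of \<open>A - m\<close> at \<open>w - c *\<^sub>R p\<close>, a quadratic polynomial in \<open>c\<close>.\<close>
  have key: "2 * (p \<bullet> p) * c \<le> c\<^sup>2 * K" for c
  proof -
    let ?u = "w - c *\<^sub>R p"
    have "?u \<bullet> (A *v ?u) = m - 2 * c * (p \<bullet> p) + c\<^sup>2 * (p \<bullet> (A *v p))"
      using sw pw by (simp add: m_def algebra_simps power2_eq_square inner_diff_left inner_diff_right)
    moreover have "?u \<bullet> ?u = 1 + c\<^sup>2 * (p \<bullet> p)"
      using ww wp by (simp add: algebra_simps power2_eq_square inner_diff_left inner_diff_right inner_commute)
    ultimately show ?thesis
      using ray [of ?u] by (simp add: K_def algebra_simps)
  qed
  have "p \<bullet> p = 0"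
  proof (rule ccontr)
    assume "p \<bullet> p \<noteq> 0"
    then have pos: "p \<bullet> p > 0" by (simp add: inner_gt_zero_iff)
    \<comment> \<open>A value small enough for the linear term of that polynomial to dominate; the summand \<open>1\<close>
      covers \<open>K = 0\<close>.\<close>
    define c where "c = (p \<bullet> p) / (K + 1)"
    have c: "c > 0" "c * (K + 1) = p \<bullet> p" using pos K by (auto simp: c_def)
    have "c * (2 * (p \<bullet> p)) \<le> c * (c * K)"
      using key [of c] by (simp add: power2_eq_square mult_ac)
    then have "2 * (p \<bullet> p) \<le> c * K" using c(1) by simp
    then show False using c pos by (simp add: algebra_simps)
  qed
  then have "A *v w = m *\<^sub>R w" by (simp add: p_def)
  moreover have "w \<noteq> 0" using w by auto
  ultimately show thesis using ray that by blast
qed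

text \<open>
  For a symmetric matrix, \<open>lambda_min\<close> is the minimum of a finite set of eigenvalues that contains
  the minimum of the Rayleigh quotient.
\<close>

lemma lambda_min_le_rayleigh:
  assumes "symmetric_matrix (A :: real^'d::finite^'d)"
  shows "lambda_min A * (u \<bullet> u) \<le> u \<bullet> (A *v u)"
proof -
  obtain m w where w: "w \<noteq> 0" "A *v w = m *\<^sub>R w" and ray: "m * (u \<bullet> u) \<le> u \<bullet> (A *v u)"
    using rayleigh_minimum_eigenvalue [OF assms] by metis
  have "lambda_min A \<le> m"
    unfolding lambda_min_def
    using w by (intro Min_le symmetric_matrix_finite_eigenvalues assms) auto
  then have "lambda_min A * (u \<bullet> u) \<le> m * (u \<bullet> u)"
    by (simp add: mult_right_mono)
  with ray show ?thesis by linarith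
qed

text \<open>
  Pair the step equation with \<open>s\<close>: the part of the regularization beyond \<open>\<mu>\<close> compensates the least
  eigenvalue of \<open>A\<close>, so that \<open>\<mu> * (s \<bullet> s) \<le> - (s \<bullet> g)\<close>.
\<close>

lemma regularized_step_bound:
  fixes A :: "real^'d::finite^'d"
  assumes sym: "symmetric_matrix A"
    and step: "(A + (\<mu> + max 0 (- lambda_min A)) *\<^sub>R mat 1) *v s = - g"
  shows "\<mu> * norm s \<le> norm g"
proof (cases "s = 0")
  case False
  let ?\<delta> = "max 0 (- lambda_min A)"
  have "s \<bullet> (A *v s) + (\<mu> + ?\<delta>) * (s \<bullet> s) = - (s \<bullet> g)"
    using arg_cong [OF step, of "\<lambda>y. s \<bullet> y"]
    by (simp add: matrix_vector_mult_add_rdistrib matrix_vector_mult_scaleR_left inner_add_right)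
  moreover have "0 \<le> s \<bullet> (A *v s) + ?\<delta> * (s \<bullet> s)"
  proof -
    have "0 \<le> (lambda_min A + ?\<delta>) * (s \<bullet> s)" by (intro mult_nonneg_nonneg) auto
    then show ?thesis using lambda_min_le_rayleigh [OF sym, of s] by (simp add: algebra_simps)
  qed
  moreover have "- (s \<bullet> g) \<le> norm s * norm g"
    using Cauchy_Schwarz_ineq2 [of s g] by linarith
  ultimately have "norm s * (\<mu> * norm s) \<le> norm s * norm g"
    by (simp add: algebra_simps dot_square_norm power2_eq_square)
  then show ?thesis using False by simp
qed simp

text \<open>
  The choice \<open>\<mu> = sqrt (M * norm g)\<close> makes \<open>norm g = \<mu>\<^sup>2 / M\<close>, so the bound \<open>\<mu> * norm s \<le> norm g\<close>
  becomes linear in \<open>\<mu>\<close> and hence can be averaged over the agents.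
\<close>

lemma scaled_step_le_regularization:
  fixes A :: "real^'d::finite^'d"
  assumes sym: "symmetric_matrix A" and M: "M > 0"
    and zero: "g = 0 \<Longrightarrow> s = 0"
    and step: "g \<noteq> 0 \<Longrightarrow> (A + (sqrt (M * norm g) + max 0 (- lambda_min A)) *\<^sub>R mat 1) *v s = - g"
  shows "M * norm s \<le> sqrt (M * norm g)"
proof (cases "g = 0")
  case True
  then show ?thesis using zero by simp
next
  case False
  let ?\<mu> = "sqrt (M * norm g)"
  have pos: "?\<mu> > 0" using M False by simp
  have "M * (?\<mu> * norm s) \<le> M * norm g"
    using regularized_step_bound [OF sym step [OF False]] M by simp
  also have "\<dots> = ?\<mu> * ?\<mu>" using M by simp
  finally have "?\<mu> * (M * norm s) \<le> ?\<mu> * ?\<mu>" by (simp only: mult_ac)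
  then show ?thesis using pos by (simp only: mult_le_cancel_left_pos)
qed

section \<open>The inexact Newton residual\<close>

lemma (in disgrem) average_gradient_estimate:
  assumes "doubly_stochastic W"
  shows "avg (gt k) = avg (\<lambda>i. gradient (f i) (x k i))"
  by (rule tracking_average [where v = "\<lambda>k i. gradient (f i) (x k i)"
        and q = g and qt = gt and a = \<tau> and b = t and k = k])
     (fact assms g_0 gt_eq g_Suc)+

lemma (in disgrem) average_hessian_estimate:
  assumes "doubly_stochastic W"
  shows "avg (Ht k) = avg (\<lambda>i. hessian (f i) (x k i))"
  by (rule tracking_average [where v = "\<lambda>k i. hessian (f i) (x k i)"
        and q = H and qt = Ht and a = \<tau> and b = t and k = k])
     (fact assms H_0 Ht_eq H_Suc)+

lemma (in disgrem) symmetric_hessian_estimate: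
  assumes hess: "\<And>i y. symmetric_matrix (hessian (f i) y)"
  shows "symmetric_matrix (Ht k i)"
proof -
  have "\<forall>i. symmetric_matrix (H k i)"
  proof (induction k)
    case 0
    show ?case by (simp add: H_0 hess)
  next
    case (Suc k)
    have "symmetric_matrix (Ht k j)" for j
      unfolding Ht_eq using Suc by (intro symmetric_matrix_mix) simp
    then show ?case
      unfolding H_Suc
      by (intro allI symmetric_matrix_mix symmetric_matrix_diff symmetric_matrix_add hess)
  qed
  then show ?thesis unfolding Ht_eq by (intro symmetric_matrix_mix) simp
qed

lemma (in disgrem) step_average_bound:
  assumes "\<And>i y. symmetric_matrix (hessian (f i) y)"
  shows "M * norm (avg (s k)) \<le> avg (\<lambda>i. lam k i + del k i)"
proof -
  have step: "M * norm (s k i) \<le> lam k i + del k i" for i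
  proof -
    have "M * norm (s k i) \<le> sqrt (M * norm (gt k i))"
    proof (rule scaled_step_le_regularization)
      show "symmetric_matrix (Ht k i)" by (rule symmetric_hessian_estimate [OF assms])
      show "(Ht k i + (sqrt (M * norm (gt k i)) + max 0 (- lambda_min (Ht k i))) *\<^sub>R mat 1) *v s k i
          = - gt k i" if "gt k i \<noteq> 0"
        using s_solves [OF that] by (simp add: lam_eq del_eq)
    qed (use M_pos s_zero in auto)
    also have "\<dots> \<le> lam k i + del k i" by (simp add: lam_eq del_eq)
    finally show ?thesis .
  qed
  have "M * norm (avg (s k)) \<le> M * avg (\<lambda>i. norm (s k i))"
    using M_pos by (simp add: norm_avg_le)
  also have "\<dots> \<le> avg (\<lambda>i. lam k i + del k i)"
    unfolding avg_mult_left [symmetric] by (intro avg_mono step)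
  finally show ?thesis .
qed

text \<open>
  The vector \<open>s + matrix_inv A *v g\<close> is the deviation of \<open>s\<close> from the exact Newton step
  \<open>- (matrix_inv A *v g)\<close>, whose residual with the data \<open>A\<close>, \<open>g\<close> vanishes.  What remains is the effect
  of replacing \<open>B\<close> and \<open>g\<close> by \<open>B'\<close> and \<open>g'\<close>.
\<close>

lemma newton_residual_decomposition:
  fixes A B B' :: "real^'d::finite^'d"
  assumes "invertible A" and "A = B + \<mu> *\<^sub>R mat 1"
  shows "(B' + \<mu> *\<^sub>R mat 1) *v s + g' = A *v (s + matrix_inv A *v g) + (B' - B) *v s + (g' - g)"
proof -
  have "A *v (matrix_inv A *v g) = g"
    using someI_ex [OF assms(1) [unfolded invertible_def], folded matrix_inv_def]
    by (simp add: matrix_vector_mul_assoc)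
  then show ?thesis
    using assms(2) by (simp add: matrix_vector_right_distrib algebra_simps)
qed

text \<open>
  Serves both for the gradients and for the Hessians, the latter after application to a fixed vector.
\<close>

lemma norm_average_error:
  fixes z :: "'n::finite \<Rightarrow> 'a::real_normed_vector" and \<Phi> :: "'n \<Rightarrow> 'a \<Rightarrow> 'b::real_normed_vector"
  assumes "\<And>i y z. norm (\<Phi> i y - \<Phi> i z) \<le> L * norm (y - z)" and "L \<ge> 0"
  shows "norm (avg (\<lambda>i. \<Phi> i (avg z)) - avg (\<lambda>i. \<Phi> i (z i))) \<le> L * consensus_dev z"
proof -
  have "norm (avg (\<lambda>i. \<Phi> i (avg z)) - avg (\<lambda>i. \<Phi> i (z i)))
      \<le> avg (\<lambda>i. norm (\<Phi> i (avg z) - \<Phi> i (z i)))"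
    unfolding avg_diff [symmetric] by (rule norm_avg_le)
  also have "\<dots> \<le> avg (\<lambda>i. L * norm (z i - avg z))"
    using assms(1) by (intro avg_mono) (metis norm_minus_commute)
  also have "\<dots> \<le> L * consensus_dev z"
    unfolding avg_mult_left by (intro mult_left_mono avg_dev_le_consensus_dev assms(2))
  finally show ?thesis .
qed

theorem proposition5p14:
  fixes f :: "'n::finite \<Rightarrow> real^'d::finite \<Rightarrow> real"
    and F :: "real^'d \<Rightarrow> real"
    and W :: "real^'n^'n"
    and M L1 L2 \<eta> lamk :: real
    and \<tau> t :: "nat \<Rightarrow> nat"
    and x g xt gt s :: "nat \<Rightarrow> 'n \<Rightarrow> real^'d"
    and H Ht :: "nat \<Rightarrow> 'n \<Rightarrow> real^'d^'d"
    and lam del :: "nat \<Rightarrow> 'n \<Rightarrow> real"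
    and k :: nat
    and xbar sbar sref r :: "real^'d"
    and Aref :: "real^'d^'d"
  defines "F \<equiv> \<lambda>y. avg (\<lambda>i. f i y)"
    and "xbar \<equiv> avg (x k)"
    and "sbar \<equiv> avg (s k)"
    and "lamk \<equiv> avg (\<lambda>i. lam k i + del k i)"
    and "Aref \<equiv> avg (Ht k) + lamk *\<^sub>R mat 1"
    and "sref \<equiv> - (matrix_inv Aref *v avg (gt k))"
    and "r \<equiv> (hessian F xbar + lamk *\<^sub>R mat 1) *v sbar + gradient F xbar"
  assumes f_convex: "\<And>i. convex_on UNIV (f i)"
    and f_C2: "\<And>i. twice_continuously_differentiable (f i)"
    and grad_lipschitz: "\<And>i y z.
        norm (gradient (f i) y - gradient (f i) z) \<le> L1 * norm (y - z)"
    and hess_lipschitz: "\<And>i y z.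
        spectral_norm (hessian (f i) y - hessian (f i) z) \<le> L2 * norm (y - z)"
    and W_stochastic: "doubly_stochastic W"
    and W_symmetric: "transpose W = W"
    and W_diag: "\<And>i. W $ i $ i > 0"
    and W_rho: "spectral_norm (W - (\<chi> i j. 1 / real CARD('n))) < 1"
    and F_coercive: "coercive F"
    and run: "disgrem f W M \<tau> t x g H xt gt Ht lam del s"
    and bounded: "bounded_iterates F x xt"
    and M_ge: "M \<ge> L2"
    and Aref_nonsingular: "invertible Aref"
    and eta: "0 < \<eta>" "\<eta> < 1"
    and cond1: "norm (sbar - sref) \<le> \<eta> / 8 * (lamk / (L1 + lamk)) * norm sbar"
    and cond2: "L1 * consensus_dev (x k) \<le> \<eta> / 8 * lamk * norm sbar"
    and cond3: "L2 * consensus_dev (x k) \<le> \<eta> / 8 * lamk"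
  shows "norm r \<le> \<eta> * lamk * norm sbar \<and> L2 * norm sbar \<le> lamk"
proof -
  interpret disgrem f W M \<tau> t x g H xt gt Ht lam del s by (rule run)
  have f_diff: "f i differentiable (at y)" and grad_diff: "gradient (f i) differentiable (at y)" for i y
    using f_C2 [of i] by (auto simp: twice_continuously_differentiable_def differentiable_on_def)
  have hess_sym: "symmetric_matrix (hessian (f i) y)" for i y
    unfolding symmetric_matrix_def
    by (intro allI hessian_inner_commute f_diff grad_diff)
  have step_bound: "M * norm sbar \<le> lamk"
    unfolding sbar_def lamk_def by (rule step_average_bound [OF hess_sym])
  have lamk: "lamk \<ge> 0"
    using step_bound M_pos by (meson mult_nonneg_nonneg norm_ge_zero less_imp_le order_trans)
  have L1: "L1 \<ge> 0"
  proof -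
    have "0 \<le> norm (gradient (f undefined) (axis undefined 1) - gradient (f undefined) 0)" by simp
    also have "\<dots> \<le> L1 * norm (axis undefined 1 - 0 :: real^'d)"
      by (rule grad_lipschitz)
    finally show ?thesis by simp
  qed
  have hess_lip: "norm (hessian (f i) y *v v - hessian (f i) z *v v) \<le> (L2 * norm v) * norm (y - z)" for i y z v
  proof -
    let ?B = "hessian (f i) y - hessian (f i) z"
    have "norm (?B *v v) \<le> spectral_norm ?B * norm v"
      unfolding spectral_norm_def by (rule onorm) simp
    also have "\<dots> \<le> (L2 * norm (y - z)) * norm v"
      by (intro mult_right_mono hess_lipschitz) simp
    finally show ?thesis by (simp add: matrix_vector_mult_diff_rdistrib mult_ac)
  qed
  have L2: "L2 \<ge> 0"
  proof -
    let ?e = "axis undefined 1 :: real^'d"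
    have "0 \<le> norm (hessian (f undefined) ?e *v ?e - hessian (f undefined) 0 *v ?e)" by simp
    also have "\<dots> \<le> L2 * norm ?e * norm (?e - 0)" by (rule hess_lip)
    finally show ?thesis by simp
  qed
  have Aref_bound: "norm (Aref *v v) \<le> (L1 + lamk) * norm v" for v
  proof -
    have "norm (avg (Ht k) *v v) \<le> avg (\<lambda>i. norm (hessian (f i) (x k i) *v v))"
      unfolding average_hessian_estimate [OF W_stochastic] avg_matrix_vector_mult by (rule norm_avg_le)
    also have "\<dots> \<le> avg (\<lambda>i::'n. L1 * norm v)"
      by (intro avg_mono norm_derivative_le_lipschitz [OF has_derivative_hessian [OF grad_diff] grad_lipschitz])
    finally have "norm (avg (Ht k) *v v) \<le> L1 * norm v" by (simp only: avg_const)
    moreover have "Aref *v v = avg (Ht k) *v v + lamk *\<^sub>R v"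
      by (simp add: Aref_def matrix_vector_mult_add_rdistrib matrix_vector_mult_scaleR_left)
    ultimately show ?thesis
      using norm_triangle_ineq [of "avg (Ht k) *v v" "lamk *\<^sub>R v"] lamk by (simp add: algebra_simps)
  qed
  define bound where "bound = \<eta> / 8 * lamk * norm sbar"
  have bound_nonneg: "bound \<ge> 0" using eta lamk by (simp add: bound_def)
  have "r = Aref *v (sbar - sref) + (hessian F xbar - avg (Ht k)) *v sbar
      + (gradient F xbar - avg (gt k))"
    unfolding r_def sref_def
    using newton_residual_decomposition [OF Aref_nonsingular Aref_def [THEN meta_eq_to_obj_eq]] by simp
  then have "norm r \<le> norm (Aref *v (sbar - sref)) + norm ((hessian F xbar - avg (Ht k)) *v sbar)
      + norm (gradient F xbar - avg (gt k))"
    by (simp add: norm_triangle_le norm_triangle_ineq)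
  moreover have "norm (Aref *v (sbar - sref)) \<le> bound"
  proof -
    have "norm (Aref *v (sbar - sref)) \<le> (L1 + lamk) * (\<eta> / 8 * (lamk / (L1 + lamk)) * norm sbar)"
      using Aref_bound [of "sbar - sref"] mult_left_mono [OF cond1, of "L1 + lamk"] L1 lamk by linarith
    also have "\<dots> \<le> bound"
    proof (cases "L1 + lamk = 0")
      \<comment> \<open>The fraction cannot be cancelled here, but the factor in front of it vanishes.\<close>
      case True
      then show ?thesis using bound_nonneg by simp
    next
      case False
      then have "(L1 + lamk) * (lamk / (L1 + lamk)) = lamk" by simp
      then have "\<eta> / 8 * ((L1 + lamk) * (lamk / (L1 + lamk))) * norm sbar = bound"
        by (simp only: bound_def)
      then show ?thesis by (simp only: mult_ac order_refl)
    qed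
    finally show ?thesis .
  qed
  moreover have "norm ((hessian F xbar - avg (Ht k)) *v sbar) \<le> bound"
  proof -
    have "(hessian F xbar - avg (Ht k)) *v sbar
        = avg (\<lambda>i. hessian (f i) (avg (x k)) *v sbar) - avg (\<lambda>i. hessian (f i) (x k i) *v sbar)"
      by (simp add: F_def xbar_def hessian_avg f_diff grad_diff average_hessian_estimate [OF W_stochastic]
          matrix_vector_mult_diff_rdistrib avg_matrix_vector_mult)
    also have "norm \<dots> \<le> (L2 * norm sbar) * consensus_dev (x k)"
      using hess_lip L2 by (intro norm_average_error) auto
    also have "\<dots> \<le> bound"
      using mult_right_mono [OF cond3, of "norm sbar"] by (simp add: bound_def mult_ac)
    finally show ?thesis .
  qed
  moreover have "norm (gradient F xbar - avg (gt k)) \<le> bound"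
  proof -
    have "gradient F xbar - avg (gt k)
        = avg (\<lambda>i. gradient (f i) (avg (x k))) - avg (\<lambda>i. gradient (f i) (x k i))"
      by (simp add: F_def xbar_def gradient_avg f_diff average_gradient_estimate [OF W_stochastic])
    also have "norm \<dots> \<le> L1 * consensus_dev (x k)"
      using grad_lipschitz L1 by (intro norm_average_error)
    also have "\<dots> \<le> bound" using cond2 by (simp add: bound_def)
    finally show ?thesis .
  qed
  \<comment> \<open>The three parts use up only three of the eight available shares of \<open>\<eta> * lamk * norm sbar\<close>.\<close>
  ultimately have "norm r \<le> 8 * bound" using bound_nonneg by linarith
  then have "norm r \<le> \<eta> * lamk * norm sbar" by (simp add: bound_def)
  moreover have "L2 * norm sbar \<le> lamk"
    using step_bound mult_right_mono [OF M_ge, of "norm sbar"] by simp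
  ultimately show ?thesis by blast
qed

end
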